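(* Let $\Phi$ denote the cumulative distribution function of the standard normal distribution. For recall level $\bar\beta \in (0,1)$ and $\varepsilon \ge 0$, $\mu$-GDP ensures the same precision as $\varepsilon$-DP if $$\mu = \Phi^{-1}(\bar\beta) - \Phi^{-1}\bigl(e^{-\varepsilon}\bar\beta\bigr).$$
   Context: A mechanism $M$ is a randomized map taking a dataset $S$ of records from a data space $\mathbb{D}$ to a random output $\theta \sim M(S)$ in an output space $\Theta$. Given a partial dataset $\bar S \in \mathbb{D}^{n-1}$ and a target record $z \in \mathbb{D}$, a test is a function $\phi:\Theta\to[0,1]$, and its true-positive rate (also called recall) and false-positive rate are $$\mathrm{TPR}_\phi = \mathbb{E}_{\theta\sim M(\bar S\cup\{z\})}[\phi(\theta)], \qquad \mathrm{FPR}_\phi = \mathbb{E}_{\theta\sim M(\bar S)}[\phi(\theta)].$$ The precision of $\phi$ is $\mathrm{precision}_\phi = \dfrac{\mathrm{TPR}_\phi}{\mathrm{TPR}_\phi+\mathrm{FPR}_\phi}$. The recall level $\bar\beta$ is a fixed level of $\mathrm{TPR}_\phi$. A mechanism satisfies $\varepsilon$-DP (pure differential privacy) if $e^{-\varepsilon}\le \mathrm{TPR}_\phi/\mathrm{FPR}_\phi \le e^{\varepsilon}$ for every test $\phi:\Theta\to[0,1]$ (and all $\bar S$, $z$). For any $\varepsilon$-DP mechanism, $\mathrm{precision}_\phi \le e^\varepsilon/(e^\varepsilon+1)$ for any test $\phi$. For a convex, non-increasing function $f:[0,1]\to[0,1]$, a mechanism $M$ satisfies $f$-DP if for every test $\phi:\Theta\to[0,1]$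 (and all $\bar S$, $z$), $$\mathrm{TPR}_\phi \le 1 - f(\mathrm{FPR}_\phi) \quad\text{and}\quad \mathrm{FPR}_\phi \le 1 - f(\mathrm{TPR}_\phi).$$ $M$ satisfies $\mu$-GDP (Gaussian differential privacy) if it satisfies $f_\mu$-DP with $f_\mu(a) = \Phi\bigl(\Phi^{-1}(1-a)-\mu\bigr)$. *)

theory Defs
  imports "HOL-Probability.Probability" "HOL-Library.Multiset"
begin

text \<open>
  A dataset is a finite multiset of records, so that \<open>S \<union> {z}\<close> is \<open>add_mset z S\<close>.
  The output space is a measurable space \<open>T\<close>; a mechanism sends every dataset to a
  probability measure on \<open>T\<close>.
\<close>

definition mechanism :: "'o measure \<Rightarrow> ('d multiset \<Rightarrow> 'o measure) \<Rightarrow> bool" where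
  "mechanism T M \<longleftrightarrow> (\<forall>S. M S \<in> space (prob_algebra T))"

definition is_test :: "'o measure \<Rightarrow> ('o \<Rightarrow> real) \<Rightarrow> bool" where
  "is_test T \<phi> \<longleftrightarrow> \<phi> \<in> borel_measurable T \<and> (\<forall>\<theta>\<in>space T. 0 \<le> \<phi> \<theta> \<and> \<phi> \<theta> \<le> 1)"

definition TPR :: "('d multiset \<Rightarrow> 'o measure) \<Rightarrow> 'd multiset \<Rightarrow> 'd \<Rightarrow> ('o \<Rightarrow> real) \<Rightarrow> real" where
  "TPR M S z \<phi> = (\<integral>\<theta>. \<phi> \<theta> \<partial>M (add_mset z S))"

definition FPR :: "('d multiset \<Rightarrow> 'o measure) \<Rightarrow> 'd multiset \<Rightarrow> ('o \<Rightarrow> real) \<Rightarrow> real" where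
  "FPR M S \<phi> = (\<integral>\<theta>. \<phi> \<theta> \<partial>M S)"

definition precision :: "('d multiset \<Rightarrow> 'o measure) \<Rightarrow> 'd multiset \<Rightarrow> 'd \<Rightarrow> ('o \<Rightarrow> real) \<Rightarrow> real" where
  "precision M S z \<phi> = TPR M S z \<phi> / (TPR M S z \<phi> + FPR M S \<phi>)"

text \<open>
  The full dataset has \<open>n\<close> records, so the partial dataset \<open>S\<close> has \<open>n - 1\<close>.
  The ratio condition \<open>exp (- \<epsilon>) \<le> TPR / FPR \<le> exp \<epsilon>\<close> is stated without
  division: a test with both rates 0 (such as the constant 0) satisfies it, whereas the
  HOL convention \<open>x / 0 = 0\<close> would make it fail for every mechanism.
\<close>

definition eps_DP :: "nat \<Rightarrow> 'o measure \<Rightarrow> real \<Rightarrow> ('d multiset \<Rightarrow> 'o measure) \<Rightarrow> bool" where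
  "eps_DP n T \<epsilon> M \<longleftrightarrow> mechanism T M \<and>
     (\<forall>S z \<phi>. size S = n - 1 \<longrightarrow> is_test T \<phi> \<longrightarrow>
        exp (- \<epsilon>) * FPR M S \<phi> \<le> TPR M S z \<phi> \<and> TPR M S z \<phi> \<le> exp \<epsilon> * FPR M S \<phi>)"

definition f_DP :: "nat \<Rightarrow> 'o measure \<Rightarrow> (real \<Rightarrow> real) \<Rightarrow> ('d multiset \<Rightarrow> 'o measure) \<Rightarrow> bool" where
  "f_DP n T f M \<longleftrightarrow> mechanism T M \<and>
     (\<forall>S z \<phi>. size S = n - 1 \<longrightarrow> is_test T \<phi> \<longrightarrow>
        TPR M S z \<phi> \<le> 1 - f (FPR M S \<phi>) \<and> FPR M S \<phi> \<le> 1 - f (TPR M S z \<phi>))"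

definition Phi :: "real \<Rightarrow> real" where
  "Phi x = cdf std_normal_distribution x"

text \<open>
  \<open>Phi_inv p\<close> is meaningful only for \<open>0 < p < 1\<close>, the range of \<open>Phi\<close>.
\<close>

definition Phi_inv :: "real \<Rightarrow> real" where
  "Phi_inv = inv Phi"

text \<open>
  The first two cases of \<open>gauss_tradeoff\<close> spell out the extended-real conventions
  \<open>Phi_inv 1 = \<infinity>\<close>, \<open>Phi_inv 0 = - \<infinity>\<close>, \<open>Phi \<infinity> = 1\<close>, \<open>Phi (- \<infinity>) = 0\<close>;
  only arguments in \<open>[0, 1]\<close> matter.
\<close>

definition gauss_tradeoff :: "real \<Rightarrow> real \<Rightarrow> real" where
  "gauss_tradeoff \<mu> a =
     (if a = 0 then 1 else if a = 1 then 0 else Phi (Phi_inv (1 - a) - \<mu>))"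

definition GDP :: "nat \<Rightarrow> 'o measure \<Rightarrow> real \<Rightarrow> ('d multiset \<Rightarrow> 'o measure) \<Rightarrow> bool" where
  "GDP n T \<mu> M \<longleftrightarrow> f_DP n T (gauss_tradeoff \<mu>) M"

end

theory Submission
  imports Defs
begin

text \<open>
  At recall \<open>\<beta>\<close>, precision at most \<open>exp \<epsilon> / (exp \<epsilon> + 1)\<close> means that the false-positive rate is
  at least \<open>exp (- \<epsilon>) * \<beta>\<close>. Gaussian differential privacy forces
  \<open>\<Phi>\<^sup>-\<^sup>1(TPR) \<le> \<Phi>\<^sup>-\<^sup>1(FPR) + \<mu>\<close>, and the given \<open>\<mu>\<close> turns this into exactly that bound. It is
  attained by a threshold test between the normal distributions with means \<open>0\<close> and \<open>\<mu>\<close>: by the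
  Neyman-Pearson argument threshold tests are the most powerful ones, so this pair is \<open>\<mu>\<close>-GDP.
\<close>

section \<open>Unit-variance normal distributions and the function \<open>Phi\<close>\<close>

abbreviation unit_normal :: "real \<Rightarrow> real measure" where
  "unit_normal m \<equiv> density lborel (normal_density m 1)"

lemma prob_space_unit_normal: "prob_space (unit_normal m)"
  by (rule prob_space_normal_density) simp

lemma integral_unit_normal:
  assumes "f \<in> borel_measurable borel"
  shows "(\<integral>x. f x \<partial>unit_normal m) = (\<integral>x. normal_density m 1 x * f x \<partial>lborel)"
  using assms by (subst integral_density) auto

text \<open>The density is positive everywhere, so a set that is null for it is Lebesgue null, which
  an interval of positive length is not.\<close>

lemma measure_unit_normal_pos:
  assumes "a < b"
  shows "measure (unit_normal m) {a<..b} > 0"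
proof -
  interpret prob_space "unit_normal m" by (rule prob_space_unit_normal)
  have "emeasure (unit_normal m) {a<..b} \<noteq> 0"
  proof
    assume "emeasure (unit_normal m) {a<..b} = 0"
    then have "{a<..b} \<in> null_sets (unit_normal m)" by (auto simp: null_sets_def)
    then have "AE x in lborel. x \<in> {a<..b} \<longrightarrow> ennreal (normal_density m 1 x) = 0"
      by (subst (asm) null_sets_density_iff) auto
    then have "AE x in lborel. x \<notin> {a<..b}"
    proof eventually_elim
      case (elim x)
      then show ?case using normal_density_pos[of 1 m x] by (auto simp: ennreal_eq_0_iff)
    qed
    then have "{a<..b} \<in> null_sets lborel"
      by (subst AE_iff_null_sets) auto
    then show False using assms by (auto simp: null_sets_def)
  qed
  then show ?thesis by (simp add: emeasure_eq_measure zero_less_measure_iff)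
qed

lemma strict_mono_Phi: "strict_mono Phi"
proof (rule strict_monoI)
  fix x y :: real assume "x < y"
  interpret real_distribution std_normal_distribution by (rule real_dist_normal_dist)
  show "Phi x < Phi y"
    using cdf_diff_eq[OF \<open>x < y\<close>] measure_unit_normal_pos[OF \<open>x < y\<close>, of 0]
    by (simp add: Phi_def)
qed

lemma measure_unit_normal_singleton: "measure (unit_normal m) {x} = 0"
proof -
  have "AE y in lborel. y \<in> {x} \<longrightarrow> ennreal (normal_density m 1 y) = 0"
    using AE_lborel_singleton[of x] by eventually_elim simp
  then have "{x} \<in> null_sets (unit_normal m)"
    by (intro null_sets_density_iff[THEN iffD2] conjI) simp_all
  then show ?thesis by (auto simp: null_sets_def measure_def)
qed

text \<open>A distribution function is continuous exactly where the distribution has no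
  atom.\<close>

lemma isCont_Phi: "isCont Phi x"
proof -
  interpret real_distribution std_normal_distribution by (rule real_dist_normal_dist)
  show ?thesis
    unfolding Phi_def[abs_def] isCont_cdf by (rule measure_unit_normal_singleton)
qed

text \<open>A distribution function satisfies both bounds weakly; strict monotonicity, used one unit
  to either side of \<open>x\<close>, makes them strict.\<close>

lemma Phi_pos: "0 < Phi x" and Phi_less_one: "Phi x < 1"
proof -
  interpret real_distribution std_normal_distribution by (rule real_dist_normal_dist)
  have "0 \<le> Phi (x - 1)" "Phi (x + 1) \<le> 1"
    by (auto simp: Phi_def cdf_nonneg cdf_bounded_prob)
  then show "0 < Phi x" "Phi x < 1"
    using strict_monoD[OF strict_mono_Phi, of "x - 1" x] strict_monoD[OF strict_mono_Phi, of x "x + 1"]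
    by auto
qed

text \<open>Since \<open>inv\<close> chooses some preimage whenever there is one, it is enough to
  find one. The limits 0 and 1 at the two ends give points below and above \<open>p\<close>, and
  continuity does the rest.\<close>

lemma Phi_Phi_inv:
  assumes "0 < p" "p < 1"
  shows "Phi (Phi_inv p) = p"
proof -
  interpret real_distribution std_normal_distribution by (rule real_dist_normal_dist)
  have "eventually (\<lambda>x. Phi x < p) at_bot"
    using order_tendstoD(2)[OF cdf_lim_at_bot \<open>0 < p\<close>] by (simp add: Phi_def)
  then obtain a where a: "Phi a < p"
    using eventually_happens[of _ "at_bot :: real filter"] by auto
  have "eventually (\<lambda>x. p < Phi x) at_top"
    using order_tendstoD(1)[OF cdf_lim_at_top_prob \<open>p < 1\<close>] by (simp add: Phi_def)
  then obtain b where b: "p < Phi b"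
    using eventually_happens[of _ "at_top :: real filter"] by auto
  have "a \<le> b"
    using a b strict_mono_less[OF strict_mono_Phi, of a b] by auto
  then obtain x where "Phi x = p"
    using IVT[of Phi a p b] a b isCont_Phi by auto
  then show ?thesis unfolding Phi_inv_def by (intro f_inv_into_f) auto
qed

text \<open>The power of the threshold test at \<open>c\<close>. Reflecting \<open>x\<close> to
  \<open>m - x\<close> turns the upper tail into a lower tail of the standard normal
  distribution.\<close>

lemma measure_unit_normal_greaterThan: "measure (unit_normal m) {c<..} = Phi (m - c)"
proof -
  interpret Z: real_distribution std_normal_distribution by (rule real_dist_normal_dist)
  have "measure (unit_normal m) {c<..} = (\<integral>x. normal_density m 1 x * indicator {c<..} x \<partial>lborel)"
    by (subst integral_unit_normal[symmetric]) auto
  also have "\<dots> = (\<integral>x. normal_density m 1 (m + (- 1) * x) * indicator {c<..} (m + (- 1) * x) \<partial>lborel)"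
    by (subst lborel_integral_real_affine[of "- 1" _ m]) simp_all
  also have "\<dots> = (\<integral>x. normal_density 0 1 x * indicator {..<m - c} x \<partial>lborel)"
    by (intro Bochner_Integration.integral_cong) (auto simp: normal_density_def indicator_def)
  also have "\<dots> = measure std_normal_distribution {..<m - c}"
    by (subst integral_unit_normal[symmetric]) auto
  \<comment> \<open>The end point carries no mass; adding it gives the closed half-line in the
    definition of \<open>cdf\<close>.\<close>
  also have "\<dots> = measure std_normal_distribution ({..<m - c} \<union> {m - c})"
    by (subst Z.finite_measure_Union) (auto simp: measure_unit_normal_singleton)
  also have "{..<m - c} \<union> {m - c} = {..m - c}" by auto
  finally show ?thesis by (simp add: Phi_def cdf_def)
qed

lemma Phi_uminus: "Phi (- x) = 1 - Phi x"
proof -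
  interpret real_distribution std_normal_distribution by (rule real_dist_normal_dist)
  have "Phi (- x) = prob (space std_normal_distribution - {..x})"
    using measure_unit_normal_greaterThan[of 0 x]
    by (simp add: Compl_eq_Diff_UNIV[symmetric])
  also have "\<dots> = 1 - prob {..x}" by (rule prob_compl) simp
  finally show ?thesis by (simp add: Phi_def cdf_def)
qed

section \<open>Optimal tests between two normal distributions and the Gaussian trade-off\<close>

lemma integral_test_bounds:
  assumes "prob_space N" "sets N = sets T" "is_test T \<phi>"
  shows "0 \<le> (\<integral>x. \<phi> x \<partial>N)" "(\<integral>x. \<phi> x \<partial>N) \<le> 1" "integrable N \<phi>"
proof -
  interpret prob_space N by fact
  have sp: "space N = space T" by (rule sets_eq_imp_space_eq) fact
  have bounds: "\<And>x. x \<in> space N \<Longrightarrow> 0 \<le> \<phi> x \<and> \<phi> x \<le> 1" and meas: "\<phi> \<in> borel_measurable N"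
    using assms sp measurable_cong_sets[OF assms(2) refl] by (auto simp: is_test_def)
  show int: "integrable N \<phi>"
    by (rule integrable_const_bound[where B = 1]) (use bounds meas in auto)
  show "0 \<le> (\<integral>x. \<phi> x \<partial>N)" using bounds by (intro integral_nonneg_AE) auto
  show "(\<integral>x. \<phi> x \<partial>N) \<le> 1"
    using bounds integral_mono[OF int integrable_const[of 1]] by (simp add: prob_space)
qed

lemma unit_normal_test_bounds:
  assumes "is_test borel \<phi>"
  shows "0 \<le> (\<integral>x. \<phi> x \<partial>unit_normal m)" "(\<integral>x. \<phi> x \<partial>unit_normal m) \<le> 1"
    "integrable (unit_normal m) \<phi>"
  using integral_test_bounds[OF prob_space_unit_normal _ assms] by auto

lemma normal_density_likelihood_ratio:
  "normal_density \<mu> 1 x = exp (\<mu> * x - \<mu>\<^sup>2 / 2) * normal_density 0 1 x"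
proof -
  have "- (x - \<mu>)\<^sup>2 / 2 = (\<mu> * x - \<mu>\<^sup>2 / 2) + - x\<^sup>2 / 2"
    by (simp add: power2_eq_square field_simps)
  then show ?thesis by (simp add: normal_density_def exp_add[symmetric])
qed

text \<open>The threshold test \<open>h\<close> at \<open>c\<close> has the same size as \<phi>. The
  likelihood ratio is non-decreasing in \<open>x\<close>, so its difference from its value
  \<open>k\<close> at \<open>c\<close> never has the opposite sign to \<open>h x - \<phi> x\<close>.
  Integrating the product against the standard normal density compares the powers.\<close>

lemma neyman_pearson_unit_normal:
  assumes test: "is_test borel \<phi>" and "0 \<le> \<mu>"
    and size: "(\<integral>x. \<phi> x \<partial>unit_normal 0) = Phi (- c)"
  shows "(\<integral>x. \<phi> x \<partial>unit_normal \<mu>) \<le> Phi (\<mu> - c)"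
proof -
  define k where "k = exp (\<mu> * c - \<mu>\<^sup>2 / 2)"
  define h :: "real \<Rightarrow> real" where "h = indicator {c<..}"
  have h: "is_test borel h" by (auto simp: h_def is_test_def)
  have int: "integrable lborel (\<lambda>x. normal_density m 1 x * f x)" if "is_test borel f" for m f
    using unit_normal_test_bounds(3)[OF that, of m] that
    by (subst (asm) integrable_density) (auto simp: is_test_def)
  have eq: "(\<integral>x. normal_density m 1 x * f x \<partial>lborel) = (\<integral>x. f x \<partial>unit_normal m)"
    if "is_test borel f" for m f
    using integral_unit_normal[of f m] that by (simp add: is_test_def)
  have h_int: "(\<integral>x. h x \<partial>unit_normal m) = Phi (m - c)" for m
    by (simp add: h_def measure_unit_normal_greaterThan)
  have pos: "0 \<le> (normal_density \<mu> 1 x * h x - normal_density \<mu> 1 x * \<phi> x)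
      - k * (normal_density 0 1 x * h x - normal_density 0 1 x * \<phi> x)" (is "0 \<le> ?g x") for x
  proof -
    have "?g x = normal_density 0 1 x * ((exp (\<mu> * x - \<mu>\<^sup>2 / 2) - k) * (h x - \<phi> x))"
      by (simp add: normal_density_likelihood_ratio[of \<mu>] algebra_simps)
    also have "0 \<le> \<dots>"
    proof (cases "c < x")
      case True
      then have "k \<le> exp (\<mu> * x - \<mu>\<^sup>2 / 2)" using \<open>0 \<le> \<mu>\<close> by (simp add: k_def mult_left_mono)
      then show ?thesis using True test by (auto simp: h_def is_test_def)
    next
      case False
      then have "exp (\<mu> * x - \<mu>\<^sup>2 / 2) \<le> k" using \<open>0 \<le> \<mu>\<close> by (simp add: k_def mult_left_mono)
      then show ?thesis using False test
        by (intro mult_nonneg_nonneg mult_nonpos_nonpos) (auto simp: h_def is_test_def)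
    qed
    finally show ?thesis .
  qed
  have "0 \<le> (\<integral>x. ?g x \<partial>lborel)" by (intro integral_nonneg_AE) (use pos in auto)
  \<comment> \<open>The factor of \<open>k\<close> is the difference of the two sizes and vanishes
    by \<open>size\<close>.\<close>
  also have "\<dots> = (Phi (\<mu> - c) - (\<integral>x. \<phi> x \<partial>unit_normal \<mu>)) - k * (Phi (0 - c) - (\<integral>x. \<phi> x \<partial>unit_normal 0))"
    using int[OF h] int[OF test] by (simp add: eq[OF h] eq[OF test] h_int)
  finally show ?thesis using size by simp
qed

text \<open>Positive densities give all these distributions the null sets of Lebesgue measure. This
  settles the rates 0 and 1, where \<open>Phi_inv\<close> has no meaning.\<close>

lemma unit_normal_test_null:
  assumes test: "is_test borel \<phi>" and "(\<integral>x. \<phi> x \<partial>unit_normal m) = 0"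
  shows "(\<integral>x. \<phi> x \<partial>unit_normal m') = 0"
proof -
  have "AE x in unit_normal m. \<phi> x = 0"
    using assms unit_normal_test_bounds(3)[OF test, of m]
    by (subst (asm) integral_nonneg_eq_0_iff_AE) (auto simp: is_test_def)
  then have "AE x in lborel. \<phi> x = 0"
    using normal_density_pos[of 1 m] by (subst (asm) AE_density) (auto simp: less_imp_le)
  then have "AE x in unit_normal m'. \<phi> x = 0"
    by (subst AE_density) auto
  then show ?thesis by (rule integral_eq_zero_AE)
qed

text \<open>On the scale of normal quantiles the trade-off curve is a shift by \<mu>: the symmetry
  of \<open>Phi\<close> rewrites \<open>1 - gauss_tradeoff \<mu> a\<close> as
  \<open>Phi (Phi_inv a + \<mu>)\<close>, and \<open>Phi\<close> is strictly increasing.\<close>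

lemma le_one_minus_gauss_tradeoff_iff:
  assumes "0 < a" "a < 1" "0 < b" "b < 1"
  shows "b \<le> 1 - gauss_tradeoff \<mu> a \<longleftrightarrow> Phi_inv b \<le> Phi_inv a + \<mu>"
proof -
  have "Phi (- Phi_inv a) = Phi (Phi_inv (1 - a))"
    using assms by (simp add: Phi_uminus Phi_Phi_inv)
  then have "Phi_inv (1 - a) = - Phi_inv a"
    using strict_mono_eq[OF strict_mono_Phi] by metis
  then have "1 - gauss_tradeoff \<mu> a = Phi (Phi_inv a + \<mu>)"
    using assms Phi_uminus[of "Phi_inv a + \<mu>"] by (simp add: gauss_tradeoff_def)
  moreover have "b = Phi (Phi_inv b)" using assms by (simp add: Phi_Phi_inv)
  ultimately show ?thesis using strict_mono_less_eq[OF strict_mono_Phi] by metis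
qed

lemma unit_normal_tradeoff:
  assumes test: "is_test borel \<phi>" and "0 \<le> \<mu>"
  defines "a \<equiv> \<integral>x. \<phi> x \<partial>unit_normal 0" and "b \<equiv> \<integral>x. \<phi> x \<partial>unit_normal \<mu>"
  shows "b \<le> 1 - gauss_tradeoff \<mu> a" "a \<le> 1 - gauss_tradeoff \<mu> b"
proof -
  have ab: "0 \<le> a" "a \<le> 1" "0 \<le> b" "b \<le> 1"
    using unit_normal_test_bounds[OF test] by (auto simp: a_def b_def)
  \<comment> \<open>The second inequality is the first one for the complementary test \<open>1 - \<phi>\<close>.\<close>
  have test': "is_test borel (\<lambda>x. 1 - \<phi> x)" using test by (auto simp: is_test_def)
  have compl: "(\<integral>x. 1 - \<phi> x \<partial>unit_normal m) = 1 - (\<integral>x. \<phi> x \<partial>unit_normal m)" for m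
  proof -
    interpret prob_space "unit_normal m" by (rule prob_space_unit_normal)
    show ?thesis using unit_normal_test_bounds(3)[OF test, of m]
      by (subst Bochner_Integration.integral_diff) (auto simp: prob_space[simplified])
  qed
  \<comment> \<open>The rate 0 is shared by both distributions; applied to the complementary test
    this gives the same for the rate 1.\<close>
  have zero: "a = 0 \<longleftrightarrow> b = 0" and one: "a = 1 \<longleftrightarrow> b = 1"
    using unit_normal_test_null[OF test, of 0 \<mu>] unit_normal_test_null[OF test, of \<mu> 0]
      unit_normal_test_null[OF test', of 0 \<mu>] unit_normal_test_null[OF test', of \<mu> 0]
    unfolding compl a_def[symmetric] b_def[symmetric] by linarith+
  consider "a = 0" "b = 0" | "a = 1" "b = 1" | "0 < a" "a < 1" "0 < b" "b < 1"
    using ab zero one by fastforce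
  then have "b \<le> 1 - gauss_tradeoff \<mu> a \<and> a \<le> 1 - gauss_tradeoff \<mu> b"
  proof cases
    case 3
    have "Phi_inv b \<le> Phi_inv a + \<mu>"
    proof -
      \<comment> \<open>The threshold \<open>- Phi_inv a\<close> is the one whose test has size
        \<open>a\<close>.\<close>
      have "b \<le> Phi (\<mu> - (- Phi_inv a))"
        unfolding b_def using 3
        by (intro neyman_pearson_unit_normal test \<open>0 \<le> \<mu>\<close>) (simp add: Phi_Phi_inv flip: a_def)
      moreover have "b = Phi (Phi_inv b)" using 3 by (simp add: Phi_Phi_inv)
      ultimately show ?thesis
        using strict_mono_less_eq[OF strict_mono_Phi, of "Phi_inv b" "\<mu> - (- Phi_inv a)"] by simp
    qed
    moreover have "Phi_inv a \<le> Phi_inv b + \<mu>"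
    proof -
      \<comment> \<open>The threshold \<open>Phi_inv a\<close> has size \<open>1 - a\<close>, that
        of the complementary test.\<close>
      have "1 - b \<le> Phi (\<mu> - Phi_inv a)"
        using 3 neyman_pearson_unit_normal[OF test' \<open>0 \<le> \<mu>\<close>, of "Phi_inv a"]
        by (simp add: Phi_Phi_inv Phi_uminus compl flip: a_def b_def)
      then have "Phi (Phi_inv a - \<mu>) \<le> Phi (Phi_inv b)"
        using 3 Phi_uminus[of "Phi_inv a - \<mu>"] by (simp add: Phi_Phi_inv)
      then show ?thesis by (simp add: strict_mono_less_eq[OF strict_mono_Phi])
    qed
    ultimately show ?thesis using 3 by (simp add: le_one_minus_gauss_tradeoff_iff)
  qed (simp_all add: gauss_tradeoff_def)
  then show "b \<le> 1 - gauss_tradeoff \<mu> a" "a \<le> 1 - gauss_tradeoff \<mu> b" by auto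
qed

text \<open>The output depends on the number of records only, so every partial dataset of
  \<open>n - 1\<close> records and its extension give the same pair of normal distributions, with
  means 0 and \<mu>.\<close>

lemma GDP_two_normals:
  assumes "1 \<le> n" "0 \<le> \<mu>"
  shows "GDP n borel \<mu> (\<lambda>S. unit_normal (if size S = n - 1 then 0 else \<mu>))"
  unfolding GDP_def f_DP_def mechanism_def
proof (intro conjI allI impI)
  show "unit_normal (if size S = n - 1 then 0 else \<mu>) \<in> space (prob_algebra borel)"
    for S :: "'a multiset"
    using prob_space_unit_normal by (simp add: space_prob_algebra)
qed (use assms unit_normal_tradeoff in \<open>auto simp: TPR_def FPR_def\<close>)

section \<open>Precision bounds and their attainment\<close>

lemma mechanism_rates_nonneg:
  assumes "mechanism T M" "is_test T \<phi>"
  shows "0 \<le> TPR M S z \<phi>" "0 \<le> FPR M S \<phi>" "FPR M S \<phi> \<le> 1"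
  using assms integral_test_bounds[of "M _" T \<phi>]
  by (auto simp: mechanism_def TPR_def FPR_def space_prob_algebra)

lemma precision_le:
  assumes "0 \<le> TPR M S z \<phi>" "0 \<le> FPR M S \<phi>" "TPR M S z \<phi> \<le> exp \<epsilon> * FPR M S \<phi>"
  shows "precision M S z \<phi> \<le> exp \<epsilon> / (exp \<epsilon> + 1)"
\<comment> \<open>If both rates are 0, the convention \<open>x / 0 = 0\<close> makes the precision
  0.\<close>
proof (cases "TPR M S z \<phi> + FPR M S \<phi> = 0")
  case False
  then have "0 < TPR M S z \<phi> + FPR M S \<phi>" using assms by linarith
  moreover have "0 < exp \<epsilon> + 1" by (simp add: add_pos_pos)
  ultimately show ?thesis using assms by (simp add: precision_def divide_simps algebra_simps)
qed (simp add: precision_def)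

text \<open>Ensuring the same precision is expressed by three claims: the reference bound under pure
  privacy, the same bound under Gaussian privacy at recall \<beta>, and a mechanism and test
  attaining it, so that at this recall no smaller bound holds in general.\<close>

theorem proposition3p2:
  fixes \<beta> \<epsilon> \<mu> :: real and n :: nat and T :: "'o measure"
  assumes "0 < \<beta>" and "\<beta> < 1" and "0 \<le> \<epsilon>" and "1 \<le> n"
    and "\<mu> = Phi_inv \<beta> - Phi_inv (exp (- \<epsilon>) * \<beta>)"
  shows "(\<forall>(M :: 'd multiset \<Rightarrow> 'o measure) S z \<phi>.
            eps_DP n T \<epsilon> M \<longrightarrow> size S = n - 1 \<longrightarrow> is_test T \<phi> \<longrightarrow>
            precision M S z \<phi> \<le> exp \<epsilon> / (exp \<epsilon> + 1)) \<and>
         (\<forall>(M :: 'd multiset \<Rightarrow> 'o measure) S z \<phi>.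
            GDP n T \<mu> M \<longrightarrow> size S = n - 1 \<longrightarrow> is_test T \<phi> \<longrightarrow> TPR M S z \<phi> = \<beta> \<longrightarrow>
            precision M S z \<phi> \<le> exp \<epsilon> / (exp \<epsilon> + 1)) \<and>
         (\<exists>(M :: 'd multiset \<Rightarrow> real measure) S z \<phi>.
            GDP n borel \<mu> M \<and> size S = n - 1 \<and> is_test borel \<phi> \<and> TPR M S z \<phi> = \<beta> \<and>
            precision M S z \<phi> = exp \<epsilon> / (exp \<epsilon> + 1))"
proof -
  \<comment> \<open>The false-positive rate at which recall \<beta> gives precision exactly
    \<open>exp \<epsilon> / (exp \<epsilon> + 1)\<close>.\<close>
  define \<alpha> where "\<alpha> = exp (- \<epsilon>) * \<beta>"
  have "\<alpha> \<le> 1 * \<beta>"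
    unfolding \<alpha>_def using assms by (intro mult_right_mono) auto
  then have "\<alpha> \<le> \<beta>" "\<alpha> < 1" using \<open>\<beta> < 1\<close> by auto
  then have \<alpha>: "0 < \<alpha>" "\<alpha> \<le> \<beta>" "\<alpha> < 1" "\<beta> = exp \<epsilon> * \<alpha>"
    using \<open>0 < \<beta>\<close> by (auto simp: \<alpha>_def exp_minus)
  show ?thesis
  proof (intro conjI allI impI)
    fix M :: "'d multiset \<Rightarrow> 'o measure" and S :: "'d multiset" and z
      and \<phi> :: "'o \<Rightarrow> real"
    assume "eps_DP n T \<epsilon> M" "size S = n - 1" "is_test T \<phi>"
    then show "precision M S z \<phi> \<le> exp \<epsilon> / (exp \<epsilon> + 1)"
      using mechanism_rates_nonneg[of T M \<phi>] by (intro precision_le) (auto simp: eps_DP_def)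
  next
    fix M :: "'d multiset \<Rightarrow> 'o measure" and S :: "'d multiset" and z
      and \<phi> :: "'o \<Rightarrow> real"
    assume GDP: "GDP n T \<mu> M" "size S = n - 1" "is_test T \<phi>" and TPR: "TPR M S z \<phi> = \<beta>"
    let ?a = "FPR M S \<phi>"
    have a: "0 \<le> ?a" "?a \<le> 1" "\<beta> \<le> 1 - gauss_tradeoff \<mu> ?a"
      using GDP TPR mechanism_rates_nonneg[of T M \<phi> S]
      by (auto simp: GDP_def f_DP_def)
    \<comment> \<open>At false-positive rate 0 the trade-off value is 1, which would force recall
      0.\<close>
    have "?a \<noteq> 0" using a(3) \<open>0 < \<beta>\<close> by (auto simp: gauss_tradeoff_def)
    have "\<alpha> \<le> ?a"
    proof (cases "?a = 1")
      case False
      then have "Phi_inv \<beta> \<le> Phi_inv ?a + \<mu>"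
        using a assms \<open>?a \<noteq> 0\<close> by (subst le_one_minus_gauss_tradeoff_iff[symmetric]) auto
      \<comment> \<open>Inserting \<mu> cancels \<open>Phi_inv \<beta>\<close> and leaves
        \<open>Phi_inv \<alpha> \<le> Phi_inv ?a\<close>.\<close>
      then have "Phi (Phi_inv \<alpha>) \<le> Phi (Phi_inv ?a)"
        by (simp add: assms(5) \<alpha>_def strict_mono_less_eq[OF strict_mono_Phi])
      then show ?thesis using \<alpha> a False \<open>?a \<noteq> 0\<close> by (simp add: Phi_Phi_inv)
    qed (use \<alpha> in auto)
    then show "precision M S z \<phi> \<le> exp \<epsilon> / (exp \<epsilon> + 1)"
      using \<alpha> a TPR \<open>0 < \<beta>\<close> by (intro precision_le) auto
  next
    \<comment> \<open>The order of \<alpha> and \<beta> makes \<mu> nonnegative, as the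
      Neyman-Pearson argument with upper thresholds requires.\<close>
    have "Phi (Phi_inv \<alpha>) \<le> Phi (Phi_inv \<beta>)" using \<alpha> assms by (simp add: Phi_Phi_inv)
    then have "0 \<le> \<mu>"
      by (simp add: assms(5) \<alpha>_def strict_mono_less_eq[OF strict_mono_Phi])
    define M :: "'d multiset \<Rightarrow> real measure"
      where "M = (\<lambda>S. unit_normal (if size S = n - 1 then 0 else \<mu>))"
    \<comment> \<open>This threshold has size \<alpha> under mean 0; under mean \<mu> its power is
      \<open>Phi (\<mu> + Phi_inv \<alpha>)\<close>, which is \<beta>.\<close>
    define \<phi> :: "real \<Rightarrow> real" where "\<phi> = indicator {- Phi_inv \<alpha><..}"
    \<comment> \<open>The mechanism sees only the size of a dataset, so an arbitrary record and
      \<open>n - 1\<close> copies of it serve as target and partial dataset.\<close>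
    define z :: 'd where "z = undefined"
    let ?S = "replicate_mset (n - 1) z"
    have "n \<noteq> n - 1" using \<open>1 \<le> n\<close> by simp
    then have "TPR M ?S z \<phi> = Phi (\<mu> + Phi_inv \<alpha>)"
      using \<open>1 \<le> n\<close> by (simp add: TPR_def M_def \<phi>_def measure_unit_normal_greaterThan)
    then have TPR: "TPR M ?S z \<phi> = \<beta>"
      using assms by (simp add: \<alpha>_def Phi_Phi_inv)
    have FPR: "FPR M ?S \<phi> = \<alpha>"
      using \<alpha> by (simp add: FPR_def M_def \<phi>_def measure_unit_normal_greaterThan Phi_Phi_inv)
    have "precision M ?S z \<phi> = exp \<epsilon> * \<alpha> / ((exp \<epsilon> + 1) * \<alpha>)"
      unfolding precision_def TPR FPR using \<alpha>(4) by (simp add: algebra_simps)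
    also have "\<dots> = exp \<epsilon> / (exp \<epsilon> + 1)" using \<alpha>(1) by simp
    finally have "precision M ?S z \<phi> = exp \<epsilon> / (exp \<epsilon> + 1)" .
    moreover have "GDP n borel \<mu> M"
      unfolding M_def by (rule GDP_two_normals) fact+
    moreover have "is_test borel \<phi>" by (auto simp: is_test_def \<phi>_def)
    ultimately show "\<exists>(M :: 'd multiset \<Rightarrow> real measure) S z \<phi>.
        GDP n borel \<mu> M \<and> size S = n - 1 \<and> is_test borel \<phi> \<and> TPR M S z \<phi> = \<beta> \<and>
        precision M S z \<phi> = exp \<epsilon> / (exp \<epsilon> + 1)"
      using TPR by (intro exI[of _ M] exI[of _ ?S] exI[of _ z] exI[of _ \<phi>]) simp
  qed
qed

end
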